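(* Let $\rho\in\mathbb{Q}\cap(-1,1)$ and $q\in\mathbb{Q}$ be such that $\tau(q)$ is non-degenerate, and let $k=\frac{2(1-\rho)}{1-q}$. Suppose that $k\tau(q)$ is scalene and that $\bigl(k\tau(q),\iota(u_0)\bigr)$ is a genuine pair, with $u_0\in\mathbb{Q}$. Let $t\in\mathbb{Q}$ be defined by $u_0=2t(1-\rho)$, and put \[ \Delta_{t,q}=-(q-1)(q+2t+1)\bigl(3q^2t^2+q^2-2qt^3+2q+2t^3-3t^2+1\bigr). \] Then the fixed triangle $k\tau(q)$ has a second genuine rational isosceles partner (i.e. one other than $\iota(u_0)$) if and only if $\Delta_{t,q}$ is a nonzero square in $\mathbb{Q}$. When this condition holds, the second partner is $\iota(u_1)$, where \[ u_1=\frac{-u_0-\sqrt{\,4(1-\rho^2)-3u_0^2\,}}{2}. \] In particular, a fixed scalene $\theta$-triangle (where $\cos\theta=\rho$) has at most two genuine rational isosceles partners.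
   Context: For $\rho\in\mathbb{Q}\cap(-1,1)$ and $q,u\in\mathbb{Q}$ consider triangles given by their triples of side lengths: \[ \tau(q)=\bigl(2(\rho-q),\,1-q^{2},\,q^{2}-2\rho q+1\bigr),\qquad \iota(u)=\bigl(2(1-\rho^{2}-u^{2}),\,u^{2}-\rho^{2}+1,\,u^{2}-\rho^{2}+1\bigr). \] The angle between the first two sides of $\tau(q)$ is the angle $\theta$ with $\cos\theta=\rho$; a rational triangle with an angle $\theta$ is called a $\theta$-triangle, and up to homothety these are the $\tau(q)$. The triangle $\tau(q)$ is non-degenerate iff $|q|<1$ and $q<\rho$; $\iota(u)$ is an isosceles triangle, and is taken to be non-degenerate iff $-\sqrt{1-\rho^2}<u<0$. For $k\in\mathbb{Q}^\times$, $k\tau(q)$ is the rescaled triangle. The pair $(k\tau(q),\iota(u))$ is a genuine pair if both triangles are non-degenerate, they have equal perimeter and equal area, i.e. \[ k(1-q)=2(1-\rho),\qquad k^2(\rho-q)(1-q^2)=-2u(1-\rho^2-u^2), \] and they are not congruent. A genuine rational isosceles partner of $k\tau(q)$ is a triangle $\iota(u)$, $u\in\mathbb{Q}$, such that $(k\tau(q),\iota(u))$ is a genuine pair. *)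

theory Defs
  imports "HOL-Analysis.Analysis"
begin

text \<open>A triangle is given by the triple of its side lengths; \<open>k *\<^sub>R T\<close> is the rescaled triangle.\<close>

type_synonym triangle = "real \<times> real \<times> real"

fun perimeter :: "triangle \<Rightarrow> real" where
  "perimeter (a, b, c) = a + b + c"

text \<open>The area of a triangle in terms of its sides is given by Heron's formula, see the theorem
  \<open>heron\<close> in \<^theory>\<open>HOL-Analysis.Simplex_Content\<close>.\<close>

fun area :: "triangle \<Rightarrow> real" where
  "area (a, b, c) =
     (let s = (a + b + c) / 2 in sqrt (s * (s - a) * (s - b) * (s - c)))"

fun scalene :: "triangle \<Rightarrow> bool" where
  "scalene (a, b, c) \<longleftrightarrow> a \<noteq> b \<and> b \<noteq> c \<and> a \<noteq> c"

text \<open>Congruence (side-side-side): the same side lengths up to order.\<close>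

fun congruent_triangles :: "triangle \<Rightarrow> triangle \<Rightarrow> bool" where
  "congruent_triangles (a, b, c) (a', b', c') \<longleftrightarrow> {#a, b, c#} = {#a', b', c'#}"

definition tau :: "real \<Rightarrow> real \<Rightarrow> triangle" where
  "tau \<rho> q = (2 * (\<rho> - q), 1 - q\<^sup>2, q\<^sup>2 - 2 * \<rho> * q + 1)"

definition iota :: "real \<Rightarrow> real \<Rightarrow> triangle" where
  "iota \<rho> u = (2 * (1 - \<rho>\<^sup>2 - u\<^sup>2), u\<^sup>2 - \<rho>\<^sup>2 + 1, u\<^sup>2 - \<rho>\<^sup>2 + 1)"

definition tau_nondegenerate :: "real \<Rightarrow> real \<Rightarrow> bool" where
  "tau_nondegenerate \<rho> q \<longleftrightarrow> \<bar>q\<bar> < 1 \<and> q < \<rho>"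

text \<open>Since \<open>iota \<rho> (- u) = iota \<rho> u\<close>, the parameter is normalised to be negative.  Non-degeneracy
  is therefore a property of the parameter and not only of the triple of sides.\<close>

definition iota_nondegenerate :: "real \<Rightarrow> real \<Rightarrow> bool" where
  "iota_nondegenerate \<rho> u \<longleftrightarrow> - sqrt (1 - \<rho>\<^sup>2) < u \<and> u < 0"

text \<open>The pair \<open>(k *\<^sub>R tau \<rho> q, iota \<rho> u)\<close> is genuine.  Rationality of the parameters is stated
  separately where it is needed.\<close>

definition genuine_pair :: "real \<Rightarrow> real \<Rightarrow> real \<Rightarrow> real \<Rightarrow> bool" where
  "genuine_pair \<rho> k q u \<longleftrightarrow>
     tau_nondegenerate \<rho> q \<and> iota_nondegenerate \<rho> u \<and>
     perimeter (k *\<^sub>R tau \<rho> q) = perimeter (iota \<rho> u) \<and>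
     area (k *\<^sub>R tau \<rho> q) = area (iota \<rho> u) \<and>
     \<not> congruent_triangles (k *\<^sub>R tau \<rho> q) (iota \<rho> u)"

text \<open>The set of genuine rational isosceles partners of \<open>k *\<^sub>R tau \<rho> q\<close>.\<close>

definition partners :: "real \<Rightarrow> real \<Rightarrow> real \<Rightarrow> triangle set" where
  "partners \<rho> k q = {iota \<rho> u | u. u \<in> \<rat> \<and> genuine_pair \<rho> k q u}"

definition Delta :: "real \<Rightarrow> real \<Rightarrow> real" where
  "Delta t q = - (q - 1) * (q + 2 * t + 1) *
     (3 * q\<^sup>2 * t\<^sup>2 + q\<^sup>2 - 2 * q * t ^ 3 + 2 * q + 2 * t ^ 3 - 3 * t\<^sup>2 + 1)"

text \<open>Up to homothety the non-degenerate \<open>tau \<rho> q\<close> are all the rational triangles with an angle whose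
  cosine is \<open>\<rho>\<close>, placed between the first two sides (law of cosines).\<close>

lemma theta_triangle_iff_tau:
  assumes "\<rho> \<in> \<rat>" "-1 < \<rho>" "\<rho> < 1"
  shows "(a \<in> \<rat> \<and> b \<in> \<rat> \<and> c \<in> \<rat> \<and> a > 0 \<and> b > 0 \<and> c > 0 \<and> c\<^sup>2 = a\<^sup>2 + b\<^sup>2 - 2 * a * b * \<rho>) \<longleftrightarrow>
    (\<exists>k\<in>\<rat>. \<exists>q\<in>\<rat>. k > 0 \<and> tau_nondegenerate \<rho> q \<and> (a, b, c) = k *\<^sub>R tau \<rho> q)"
    (is "?L \<longleftrightarrow> ?R")
proof
  assume L: ?L
  define q where "q = (b - c) / a"
  define k where "k = a / (2 * (\<rho> - q))"
  have c: "c = b - a * q" using L by (simp add: q_def)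
  have "(b - a * q)\<^sup>2 = a\<^sup>2 + b\<^sup>2 - 2 * a * b * \<rho>" using L c by simp
  then have "a * (2 * b * (\<rho> - q)) = a * (a * (1 - q\<^sup>2))"
    by (simp add: power2_eq_square algebra_simps)
  then have e: "2 * b * (\<rho> - q) = a * (1 - q\<^sup>2)" using L by simp
  have ab: "a * b * \<rho> < a * b" "- (a * b) < a * b * \<rho>"
    using L assms mult_strict_left_mono[of "-1" \<rho> "a * b"] by auto
  have "c\<^sup>2 > (a - b)\<^sup>2" "c\<^sup>2 < (a + b)\<^sup>2"
  proof -
    have "c\<^sup>2 - (a - b)\<^sup>2 = 2 * (a * b - a * b * \<rho>)"
      using L by (simp add: power2_eq_square algebra_simps)
    then have "c\<^sup>2 - (a - b)\<^sup>2 > 0" using ab by simp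
    then show "c\<^sup>2 > (a - b)\<^sup>2" by simp
    have "(a + b)\<^sup>2 - c\<^sup>2 = 2 * (a * b - (- (a * b * \<rho>)))"
      using L by (simp add: power2_eq_square algebra_simps)
    moreover have "- (a * b * \<rho>) < a * b" using ab by simp
    ultimately have "(a + b)\<^sup>2 - c\<^sup>2 > 0" by simp
    then show "c\<^sup>2 < (a + b)\<^sup>2" by simp
  qed
  then have "\<bar>a - b\<bar> < c" "c < a + b"
    using L power2_less_imp_less[of "\<bar>a - b\<bar>" c] power2_less_imp_less[of c "a + b"] by simp_all
  then have "\<bar>b - c\<bar> < a" by linarith
  then have q1: "\<bar>q\<bar> < 1" using L by (simp add: q_def)
  then have "q\<^sup>2 < 1" by (simp add: abs_square_less_1)
  then have "2 * b * (\<rho> - q) > 0" using e L by simp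
  then have qr: "q < \<rho>" using L by (simp add: zero_less_mult_iff)
  have k: "k > 0" using qr L by (simp add: k_def)
  have a: "a = k * (2 * (\<rho> - q))" using qr by (simp add: k_def)
  have "2 * (\<rho> - q) * b = 2 * (\<rho> - q) * (k * (1 - q\<^sup>2))" using e a by (simp add: algebra_simps)
  then have b: "b = k * (1 - q\<^sup>2)" using qr by simp
  have "c = k * (q\<^sup>2 - 2 * \<rho> * q + 1)"
    unfolding c b by (subst a) (simp add: power2_eq_square algebra_simps)
  moreover have "q \<in> \<rat>" using L by (simp add: q_def)
  moreover have "k \<in> \<rat>" using L \<open>q \<in> \<rat>\<close> assms by (simp add: k_def)
  ultimately show ?R using k q1 qr a b by (auto simp: tau_def tau_nondegenerate_def)
next
  assume ?R
  then obtain k q where kq: "k \<in> \<rat>" "q \<in> \<rat>" "k > 0" "\<bar>q\<bar> < 1" "q < \<rho>"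
    "a = k * (2 * (\<rho> - q))" "b = k * (1 - q\<^sup>2)" "c = k * (q\<^sup>2 - 2 * \<rho> * q + 1)"
    by (auto simp: tau_def tau_nondegenerate_def)
  have "q\<^sup>2 < 1" using kq by (simp add: abs_square_less_1)
  have "\<rho>\<^sup>2 < 1" using assms by (simp add: abs_square_less_1)
  then have "0 < (q - \<rho>)\<^sup>2 + (1 - \<rho>\<^sup>2)" by (intro add_nonneg_pos) auto
  also have "\<dots> = q\<^sup>2 - 2 * \<rho> * q + 1" by (simp add: power2_eq_square algebra_simps)
  finally have "c > 0" using kq by simp
  moreover have "c\<^sup>2 = a\<^sup>2 + b\<^sup>2 - 2 * a * b * \<rho>"
    unfolding kq by (simp add: power2_eq_square algebra_simps)
  ultimately show ?L using kq \<open>q\<^sup>2 < 1\<close> assms by auto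
qed

text \<open>The equations for equal perimeter and equal area.\<close>

lemma genuine_pair_iff:
  assumes "-1 < \<rho>" "\<rho> < 1"
  shows "genuine_pair \<rho> k q u \<longleftrightarrow>
    tau_nondegenerate \<rho> q \<and> iota_nondegenerate \<rho> u \<and>
    k * (1 - q) = 2 * (1 - \<rho>) \<and>
    k\<^sup>2 * (\<rho> - q) * (1 - q\<^sup>2) = - 2 * u * (1 - \<rho>\<^sup>2 - u\<^sup>2) \<and>
    \<not> congruent_triangles (k *\<^sub>R tau \<rho> q) (iota \<rho> u)"
proof -
  have *: "perimeter (k *\<^sub>R tau \<rho> q) = perimeter (iota \<rho> u) \<longleftrightarrow> k * (1 - q) = 2 * (1 - \<rho>)"
  proof -
    have "perimeter (k *\<^sub>R tau \<rho> q) = 2 * (1 + \<rho>) * (k * (1 - q))"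
      "perimeter (iota \<rho> u) = 2 * (1 + \<rho>) * (2 * (1 - \<rho>))"
      by (simp_all add: tau_def iota_def power2_eq_square algebra_simps)
    then show ?thesis using assms by simp
  qed
  have **: "area (k *\<^sub>R tau \<rho> q) = area (iota \<rho> u) \<longleftrightarrow>
      k\<^sup>2 * (\<rho> - q) * (1 - q\<^sup>2) = - 2 * u * (1 - \<rho>\<^sup>2 - u\<^sup>2)"
    if "tau_nondegenerate \<rho> q" "iota_nondegenerate \<rho> u"
  proof -
    have r: "\<rho>\<^sup>2 < 1" using assms by (simp add: abs_square_less_1)
    have q: "q\<^sup>2 < 1" using that by (simp add: tau_nondegenerate_def abs_square_less_1)
    have "(- u)\<^sup>2 < (sqrt (1 - \<rho>\<^sup>2))\<^sup>2"
      using that by (intro power_strict_mono) (auto simp: iota_nondegenerate_def)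
    then have u: "u\<^sup>2 < 1 - \<rho>\<^sup>2" using r by simp
    define x y where "x = k\<^sup>2 * (\<rho> - q) * (1 - q\<^sup>2)" and "y = - 2 * u * (1 - \<rho>\<^sup>2 - u\<^sup>2)"
    have x: "x \<ge> 0" using that q by (simp add: x_def tau_nondegenerate_def)
    have y: "y \<ge> 0" using that u
      by (simp add: y_def iota_nondegenerate_def mult_nonpos_nonneg)
    have "area (k *\<^sub>R tau \<rho> q) = sqrt (x\<^sup>2 * (1 - \<rho>\<^sup>2))"
      unfolding x_def tau_def scaleR_Pair area.simps Let_def real_scaleR_def
      by (rule arg_cong[of _ _ sqrt]) (simp add: field_simps power2_eq_square; simp add: algebra_simps)
    moreover have "area (iota \<rho> u) = sqrt (y\<^sup>2 * (1 - \<rho>\<^sup>2))"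
      unfolding y_def iota_def area.simps Let_def
      by (rule arg_cong[of _ _ sqrt]) (simp add: field_simps power2_eq_square; simp add: algebra_simps)
    ultimately have "area (k *\<^sub>R tau \<rho> q) = area (iota \<rho> u) \<longleftrightarrow> x = y"
      using x y r by (simp add: real_sqrt_mult)
    then show ?thesis by (simp add: x_def y_def)
  qed
  show ?thesis using * ** by (auto simp: genuine_pair_def)
qed

end

theory Submission
  imports Defs
begin

text \<open>
  Write \<open>a = 1 - \<rho>\<^sup>2\<close>.  With the perimeters equal, the area of \<open>iota \<rho> u\<close> is governed by the cubic
  \<open>u (a - u\<^sup>2)\<close>, so the parameters \<open>u\<close> of the partners of a fixed triangle are roots of one cubic
  without quadratic term.  Dividing out a known root \<open>u\<^sub>0\<close> leaves \<open>u\<^sup>2 + u u\<^sub>0 + u\<^sub>0\<^sup>2 = a\<close>, of which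
  precisely one root \<open>u\<^sub>1\<close> is negative; it automatically satisfies \<open>u\<^sub>1\<^sup>2 < a\<close>.  Hence there are at
  most two partners (\<open>card_partners_le\<close>), and a second one can only fail to exist because \<open>u\<^sub>1\<close>
  is irrational or because \<open>u\<^sub>1 = u\<^sub>0\<close>.

  The coincidence \<open>u\<^sub>1 = u\<^sub>0\<close> means \<open>3 u\<^sub>0\<^sup>2 = a\<close>, that is, \<open>iota \<rho> u\<^sub>0\<close> is equilateral.  Among
  all triangles of given perimeter only the equilateral one has maximal area, by the equality
  case of the inequality between the arithmetic and geometric means, so this cannot happen for a
  partner of a scalene triangle (\<open>scalene_imp_iota_not_equilateral\<close>).

  The rationality of \<open>u\<^sub>1\<close> says that the discriminant \<open>4 a - 3 u\<^sub>0\<^sup>2\<close> is a rational square.  In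
  terms of \<open>u\<^sub>0 = 2 t (1 - \<rho>)\<close> the area equation is linear in \<open>\<rho>\<close>, up to a
  factor \<open>(1 - \<rho>)\<^sup>2\<close>; eliminating \<open>\<rho>\<close> shows
  that the discriminant is \<open>Delta t q\<close> up to a rational square (\<open>discriminant_eq_Delta\<close>).
  That square is nonzero because the elimination breaks down only at \<open>q = 0\<close>, where
  \<open>tau \<rho> q\<close> is isosceles.
\<close>

section \<open>The roots of the area cubic\<close>

lemma iota_nondegenerate_iff: "iota_nondegenerate \<rho> u \<longleftrightarrow> u < 0 \<and> u\<^sup>2 < 1 - \<rho>\<^sup>2"
proof -
  have "- sqrt (1 - \<rho>\<^sup>2) < u \<longleftrightarrow> u\<^sup>2 < 1 - \<rho>\<^sup>2" if "u < 0"
    using that real_sqrt_less_iff[of "u\<^sup>2" "1 - \<rho>\<^sup>2"] by (auto simp: abs_if)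
  then show ?thesis by (auto simp: iota_nondegenerate_def)
qed

lemma iota_eq_iff: "iota \<rho> u = iota \<rho> v \<longleftrightarrow> u\<^sup>2 = v\<^sup>2"
  by (auto simp: iota_def)

text \<open>The smaller root \<open>x\<close> of \<open>x\<^sup>2 + x v + v\<^sup>2 = a\<close>.\<close>

definition second_root :: "real \<Rightarrow> real \<Rightarrow> real" where
  "second_root a v = (- v - sqrt (4 * a - 3 * v\<^sup>2)) / 2"

lemma discriminant_pos:
  fixes a v :: real
  assumes "v\<^sup>2 < a"
  shows "4 * a - 3 * v\<^sup>2 > 0"
  using assms zero_le_power2[of v] by linarith

lemma second_root_props:
  fixes a v :: real
  assumes "v < 0" "v\<^sup>2 < a"
  shows "(second_root a v)\<^sup>2 + second_root a v * v + v\<^sup>2 = a"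
    and "second_root a v < 0" and "(second_root a v)\<^sup>2 < a"
proof -
  define s where "s = sqrt (4 * a - 3 * v\<^sup>2)"
  have "4 * a - 3 * v\<^sup>2 > v\<^sup>2" using assms by simp
  then have "s > sqrt (v\<^sup>2)" unfolding s_def by (rule real_sqrt_less_mono)
  then have "s > - v" using assms by simp
  then show neg: "second_root a v < 0"
    by (simp add: second_root_def s_def)
  have s2: "s\<^sup>2 = 4 * a - 3 * v\<^sup>2"
    unfolding s_def using discriminant_pos[OF assms(2)] by (intro real_sqrt_pow2) simp
  have "2 * second_root a v = - v - s" by (simp add: second_root_def s_def)
  then show eq: "(second_root a v)\<^sup>2 + second_root a v * v + v\<^sup>2 = a"
    using s2 by algebra
  have "second_root a v * v > 0" using neg assms by (simp add: mult_neg_neg)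
  then show "(second_root a v)\<^sup>2 < a" using eq zero_le_power2[of v] by linarith
qed

text \<open>After division by \<open>u - v\<close> a quadratic equation in \<open>u\<close> is left.  The sum of its roots is
  \<open>- v > 0\<close>, so they cannot both be negative.\<close>

lemma area_cubic_eq_iff:
  fixes a u v :: real
  assumes "v < 0" "v\<^sup>2 < a" "u < 0"
  shows "u * (a - u\<^sup>2) = v * (a - v\<^sup>2) \<longleftrightarrow> u = v \<or> u = second_root a v"
proof -
  define w where "w = second_root a v"
  have w: "w\<^sup>2 + w * v + v\<^sup>2 = a" "w < 0" using second_root_props assms by (simp_all add: w_def)
  have "u * (a - u\<^sup>2) - v * (a - v\<^sup>2) = (u - v) * (w - u) * (u + v + w)"
    unfolding w(1)[symmetric] by (simp add: algebra_simps power2_eq_square)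
  moreover have "u + v + w \<noteq> 0" using assms w by simp
  ultimately show ?thesis unfolding w_def[symmetric] by auto
qed

lemma second_root_eq_iff:
  assumes "v < 0" "v\<^sup>2 < a"
  shows "second_root a v = v \<longleftrightarrow> 3 * v\<^sup>2 = a"
proof
  assume "second_root a v = v"
  then show "3 * v\<^sup>2 = a" using second_root_props(1)[OF assms] by (simp add: power2_eq_square)
next
  assume "3 * v\<^sup>2 = a"
  then have "4 * a - 3 * v\<^sup>2 = (3 * v)\<^sup>2" by (simp add: power_mult_distrib)
  then have "sqrt (4 * a - 3 * v\<^sup>2) = \<bar>3 * v\<bar>" by (simp only: real_sqrt_abs)
  then show "second_root a v = v" using assms by (simp add: second_root_def)
qed

lemma second_root_in_Rats_iff:
  assumes "v \<in> \<rat>" "v < 0" "v\<^sup>2 < a"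
  shows "second_root a v \<in> \<rat> \<longleftrightarrow> (\<exists>r\<in>\<rat>. 4 * a - 3 * v\<^sup>2 = r\<^sup>2)"
proof
  assume "second_root a v \<in> \<rat>"
  then have "- 2 * second_root a v - v \<in> \<rat>" using assms by simp
  moreover have "- 2 * second_root a v - v = sqrt (4 * a - 3 * v\<^sup>2)"
    by (simp add: second_root_def field_simps)
  moreover have "(sqrt (4 * a - 3 * v\<^sup>2))\<^sup>2 = 4 * a - 3 * v\<^sup>2"
    using discriminant_pos[OF assms(3)] by (intro real_sqrt_pow2) simp
  ultimately show "\<exists>r\<in>\<rat>. 4 * a - 3 * v\<^sup>2 = r\<^sup>2" by metis
next
  assume "\<exists>r\<in>\<rat>. 4 * a - 3 * v\<^sup>2 = r\<^sup>2"
  then obtain r where "r \<in> \<rat>" "sqrt (4 * a - 3 * v\<^sup>2) = \<bar>r\<bar>" by auto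
  then show "second_root a v \<in> \<rat>" using assms by (auto simp: second_root_def)
qed

section \<open>Partners of a scalene triangle\<close>

lemma scalene_not_congruent_isosceles:
  assumes "scalene T"
  shows "\<not> congruent_triangles T (x, y, y)"
proof
  obtain a b c where T: "T = (a, b, c)" by (cases T)
  assume "congruent_triangles T (x, y, y)"
  then have "{#a, b, c#} = {#x, y, y#}" by (simp add: T)
  then have "count {#a, b, c#} y \<ge> 2" by simp
  then show False using assms by (auto simp: T split: if_splits)
qed

text \<open>Congruence is no obstruction for a scalene triangle, and the perimeter does not depend on
  the parameter of the partner.  What remains of genuineness, once one partner is known, is that
  the areas of the two partners agree.\<close>

lemma genuine_pair_iff_of_scalene:
  assumes \<rho>: "-1 < \<rho>" "\<rho> < 1" and sc: "scalene (k *\<^sub>R tau \<rho> q)"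
    and pair: "genuine_pair \<rho> k q v"
  shows "genuine_pair \<rho> k q u \<longleftrightarrow>
    iota_nondegenerate \<rho> u \<and> u * (1 - \<rho>\<^sup>2 - u\<^sup>2) = v * (1 - \<rho>\<^sup>2 - v\<^sup>2)"
proof -
  have "\<not> congruent_triangles (k *\<^sub>R tau \<rho> q) (iota \<rho> u)"
    unfolding iota_def by (rule scalene_not_congruent_isosceles[OF sc])
  then show ?thesis using pair unfolding genuine_pair_iff[OF \<rho>] by auto
qed

lemma genuine_pair_iff_second_root:
  assumes "-1 < \<rho>" "\<rho> < 1" "scalene (k *\<^sub>R tau \<rho> q)" "genuine_pair \<rho> k q v"
  shows "genuine_pair \<rho> k q u \<longleftrightarrow> u = v \<or> u = second_root (1 - \<rho>\<^sup>2) v"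
proof -
  have v: "v < 0" "v\<^sup>2 < 1 - \<rho>\<^sup>2"
    using assms(4) by (auto simp: genuine_pair_def iota_nondegenerate_iff)
  show ?thesis
    unfolding genuine_pair_iff_of_scalene[OF assms] iota_nondegenerate_iff
    using area_cubic_eq_iff[OF v] second_root_props(2,3)[OF v] v by blast
qed

lemma card_partners_le:
  assumes "-1 < \<rho>" "\<rho> < 1" "scalene (k *\<^sub>R tau \<rho> q)"
  shows "finite (partners \<rho> k q) \<and> card (partners \<rho> k q) \<le> 2"
proof (cases "\<exists>v. genuine_pair \<rho> k q v")
  case True
  then obtain v where v: "genuine_pair \<rho> k q v" by blast
  let ?P = "{iota \<rho> v, iota \<rho> (second_root (1 - \<rho>\<^sup>2) v)}"
  have "partners \<rho> k q \<subseteq> ?P"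
    using genuine_pair_iff_second_root[OF assms v] by (auto simp: partners_def)
  then have "finite (partners \<rho> k q) \<and> card (partners \<rho> k q) \<le> card ?P"
    by (meson card_mono finite.emptyI finite.insertI finite_subset)
  moreover have "card ?P \<le> 2" by (simp add: card_insert_if)
  ultimately show ?thesis by linarith
qed (auto simp: partners_def)

section \<open>The equilateral case\<close>

text \<open>The equality case of the inequality between the arithmetic and geometric means: the
  difference of the two sides is a combination of the squared differences with positive
  coefficients.\<close>

lemma arith_geo_mean_3_eq:
  fixes x y z :: real
  assumes "x > 0" "y > 0" "z > 0" and eq: "27 * (x * y * z) = (x + y + z) ^ 3"
  shows "x = y"
proof -
  obtain s where s2: "2 * s = x + y + z" using that[of "(x + y + z) / 2"] by simp
  have "s > 0" using s2 assms by linarith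
  have "0 = (s + 3 * x) * (y - z)\<^sup>2 + (s + 3 * y) * (x - z)\<^sup>2 + (s + 3 * z) * (x - y)\<^sup>2"
    using eq s2 by algebra
  moreover have "0 \<le> (s + 3 * x) * (y - z)\<^sup>2" "0 \<le> (s + 3 * y) * (x - z)\<^sup>2"
    using assms \<open>s > 0\<close> by simp_all
  ultimately have "(s + 3 * z) * (x - y)\<^sup>2 \<le> 0" by linarith
  then show "x = y" using \<open>s > 0\<close> assms by (simp add: mult_le_0_iff)
qed

text \<open>An equilateral \<open>iota \<rho> u\<close> attains the maximal area for its perimeter.  In Heron's formula
  for \<open>tau \<rho> q\<close> the three factors besides the semiperimeter \<open>(1 + \<rho>) (1 - q)\<close> are
  \<open>x\<close>, \<open>y\<close>, \<open>z\<close> below, so two sides of \<open>tau \<rho> q\<close> would be equal.\<close>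

lemma scalene_imp_iota_not_equilateral:
  assumes \<rho>: "-1 < \<rho>" "\<rho> < 1" and sc: "scalene (k *\<^sub>R tau \<rho> q)"
    and pair: "genuine_pair \<rho> k q u"
  shows "3 * u\<^sup>2 \<noteq> 1 - \<rho>\<^sup>2"
proof
  assume u: "3 * u\<^sup>2 = 1 - \<rho>\<^sup>2"
  have q: "\<bar>q\<bar> < 1" "q < \<rho>" and k: "k * (1 - q) = 2 * (1 - \<rho>)"
    and area: "k\<^sup>2 * (\<rho> - q) * (1 - q\<^sup>2) = - 2 * u * (1 - \<rho>\<^sup>2 - u\<^sup>2)"
    using pair unfolding genuine_pair_iff[OF \<rho>] tau_nondegenerate_def by auto
  define x y z where "x = (1 - \<rho>) * (1 + q)" and "y = (1 - q) * (\<rho> - q)"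
    and "z = (\<rho> - q) * (1 + q)"
  have pos: "x > 0" "y > 0" "z > 0" using q \<rho> by (auto simp: x_def y_def z_def)
  have sum: "x + y + z = (1 + \<rho>) * (1 - q)"
    by (simp add: x_def y_def z_def algebra_simps)
  have "k > 0" using k q \<rho> zero_less_mult_pos2[of k "1 - q"] by simp
  \<comment> \<open>Square the area equation, which removes the sign of \<open>u\<close>, and use \<open>k (1 - q) = 2 (1 - \<rho>)\<close>
      to trade one factor \<open>k\<close> for the factor \<open>1 - \<rho>\<close> of \<open>x\<close>.\<close>
  have "k ^ 3 * (2 * (x * y * z)) = (k\<^sup>2 * (\<rho> - q) * (1 - q\<^sup>2))\<^sup>2"
    using k unfolding x_def y_def z_def by algebra
  also have "\<dots> = 4 * u\<^sup>2 * (1 - \<rho>\<^sup>2 - u\<^sup>2)\<^sup>2"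
    unfolding area by algebra
  also have "\<dots> = 16 * (u\<^sup>2) ^ 3"
    unfolding u[symmetric] by algebra
  finally have "k ^ 3 * (2 * (27 * (x * y * z))) = 16 * (3 * u\<^sup>2) ^ 3"
    by algebra
  also have "3 * u\<^sup>2 = (1 - \<rho>) * (1 + \<rho>)"
    unfolding u by algebra
  also have "16 * ((1 - \<rho>) * (1 + \<rho>)) ^ 3 = 2 * (2 * (1 - \<rho>) * (1 + \<rho>)) ^ 3"
    by algebra
  also have "\<dots> = 2 * (k * (1 - q) * (1 + \<rho>)) ^ 3"
    unfolding k ..
  also have "\<dots> = k ^ 3 * (2 * (x + y + z) ^ 3)"
    unfolding sum by algebra
  finally have "k ^ 3 * (2 * (27 * (x * y * z))) = k ^ 3 * (2 * (x + y + z) ^ 3)" .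
  then have "2 * (27 * (x * y * z)) = 2 * (x + y + z) ^ 3"
    using \<open>k > 0\<close> by (subst (asm) mult_left_cancel) simp_all
  then have "27 * (x * y * z) = (x + y + z) ^ 3" by linarith
  then have "x = y" by (rule arith_geo_mean_3_eq[OF pos])
  then have "2 * (\<rho> - q) = 1 - q\<^sup>2" by (simp add: x_def y_def algebra_simps power2_eq_square)
  then show False using sc by (simp add: tau_def)
qed

section \<open>The discriminant\<close>

text \<open>Once the factor \<open>(1 - \<rho>)\<^sup>2\<close> is cancelled, the area equation is linear in \<open>\<rho>\<close>, say
  \<open>\<rho> D = N\<close>; then \<open>(1 - \<rho>) D = (1 - q) (q + 2 t + 1)\<close> and \<open>(1 + \<rho>) D = (1 + q)\<^sup>2 + 8 t\<^sup>3 (1 - q)\<close>.  If the first product vanishes, so does the second,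
  and together they force \<open>q = 0\<close>.  Otherwise the quotient \<open>(1 + \<rho>) / (1 - \<rho>)\<close> can
  be substituted into \<open>4 (1 - \<rho>)\<^sup>2 ((1 + \<rho>) / (1 - \<rho>) - 3 t\<^sup>2)\<close>, which is the
  discriminant.\<close>

lemma discriminant_eq_Delta:
  fixes \<rho> q t u :: real
  assumes "\<rho> \<noteq> 1" "q \<noteq> 1" "q \<noteq> - 1" "q \<noteq> 0" and k: "k * (1 - q) = 2 * (1 - \<rho>)"
    and area: "k\<^sup>2 * (\<rho> - q) * (1 - q\<^sup>2) = - 2 * u * (1 - \<rho>\<^sup>2 - u\<^sup>2)"
    and u: "u = 2 * t * (1 - \<rho>)"
  shows "q + 2 * t + 1 \<noteq> 0"
    and "(4 * (1 - \<rho>\<^sup>2) - 3 * u\<^sup>2) * ((1 - q) * (q + 2 * t + 1))\<^sup>2 = (2 * (1 - \<rho>))\<^sup>2 * Delta t q"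
proof -
  define D where "D = (1 + q) + (1 - q) * (t + 4 * t ^ 3)"
  have "(1 - q) * (k\<^sup>2 * (\<rho> - q) * (1 - q\<^sup>2)) = (k * (1 - q))\<^sup>2 * (\<rho> - q) * (1 + q)"
    by algebra
  then have "(1 - q) * (- 2 * u * (1 - \<rho>\<^sup>2 - u\<^sup>2)) = (2 * (1 - \<rho>))\<^sup>2 * (\<rho> - q) * (1 + q)"
    unfolding area k .
  then have "4 * (1 - \<rho>)\<^sup>2 * ((\<rho> - q) * (1 + q) + (1 - q) * t * ((1 + \<rho>) - 4 * t\<^sup>2 * (1 - \<rho>))) = 0"
    unfolding u by algebra
  then have lin: "(\<rho> - q) * (1 + q) + (1 - q) * t * ((1 + \<rho>) - 4 * t\<^sup>2 * (1 - \<rho>)) = 0"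
    using assms by simp
  have minus: "(1 - \<rho>) * D = (1 - q) * (q + 2 * t + 1)"
    and plus: "(1 + \<rho>) * D = (1 + q)\<^sup>2 + 8 * t ^ 3 * (1 - q)"
    using lin unfolding D_def by algebra+
  show nz: "q + 2 * t + 1 \<noteq> 0"
  proof
    assume "q + 2 * t + 1 = 0"
    then have "D = 0" and q: "1 + q = - 2 * t" using minus assms by auto
    have "0 = (- 2 * t)\<^sup>2 + 8 * t ^ 3 * (1 - q)" using plus \<open>D = 0\<close> q by simp
    also have "\<dots> = 4 * t\<^sup>2 * (1 + 2 * t * (1 - q))" by algebra
    also have "2 * t = - (1 + q)" using q by simp
    also have "1 + - (1 + q) * (1 - q) = q\<^sup>2" by algebra
    finally have "t = 0" using assms by simp
    then show False using q assms by simp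
  qed
  have "D \<noteq> 0" using minus nz assms by auto
  let ?P = "3 * q\<^sup>2 * t\<^sup>2 + q\<^sup>2 - 2 * q * t ^ 3 + 2 * q + 2 * t ^ 3 - 3 * t\<^sup>2 + 1"
  have "((1 + \<rho>) - 3 * t\<^sup>2 * (1 - \<rho>)) * D = ?P"
    using minus plus by algebra
  then have "(2 * (1 - \<rho>))\<^sup>2 * Delta t q
      = (2 * (1 - \<rho>))\<^sup>2 * ((1 - \<rho>) * D * (((1 + \<rho>) - 3 * t\<^sup>2 * (1 - \<rho>)) * D))"
    unfolding minus Delta_def by simp
  also have "\<dots> = (4 * (1 - \<rho>\<^sup>2) - 3 * u\<^sup>2) * ((1 - \<rho>) * D)\<^sup>2"
    unfolding u by algebra
  finally show "(4 * (1 - \<rho>\<^sup>2) - 3 * u\<^sup>2) * ((1 - q) * (q + 2 * t + 1))\<^sup>2 = (2 * (1 - \<rho>))\<^sup>2 * Delta t q"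
    unfolding minus by simp
qed

lemma rat_square_iff_of_mult_squares:
  fixes x y b c :: real
  assumes "b \<in> \<rat>" "c \<in> \<rat>" "b \<noteq> 0" "c \<noteq> 0" "x * b\<^sup>2 = c\<^sup>2 * y" "x \<noteq> 0"
  shows "(\<exists>r\<in>\<rat>. x = r\<^sup>2) \<longleftrightarrow> (\<exists>r\<in>\<rat>. r \<noteq> 0 \<and> y = r\<^sup>2)"
proof
  assume "\<exists>r\<in>\<rat>. x = r\<^sup>2"
  then obtain r where "r \<in> \<rat>" "x = r\<^sup>2" by blast
  then have "y = (r * b / c)\<^sup>2" "r * b / c \<in> \<rat>" "r * b / c \<noteq> 0"
    using assms by (auto simp: field_simps)
  then show "\<exists>r\<in>\<rat>. r \<noteq> 0 \<and> y = r\<^sup>2" by blast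
next
  assume "\<exists>r\<in>\<rat>. r \<noteq> 0 \<and> y = r\<^sup>2"
  then obtain r where "r \<in> \<rat>" "y = r\<^sup>2" by blast
  then have "x = (r * c / b)\<^sup>2" "r * c / b \<in> \<rat>"
    using assms by (auto simp: field_simps)
  then show "\<exists>r\<in>\<rat>. x = r\<^sup>2" by blast
qed

lemma second_root_in_Rats_iff_Delta:
  assumes \<rho>: "\<rho> \<in> \<rat>" "-1 < \<rho>" "\<rho> < 1" and "q \<in> \<rat>" "t \<in> \<rat>" "u \<in> \<rat>"
    and sc: "scalene (k *\<^sub>R tau \<rho> q)" and pair: "genuine_pair \<rho> k q u"
    and u: "u = 2 * t * (1 - \<rho>)"
  shows "second_root (1 - \<rho>\<^sup>2) u \<in> \<rat> \<longleftrightarrow> (\<exists>r\<in>\<rat>. r \<noteq> 0 \<and> Delta t q = r\<^sup>2)"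
proof -
  have q: "\<bar>q\<bar> < 1" "q < \<rho>" and k: "k * (1 - q) = 2 * (1 - \<rho>)"
    and area: "k\<^sup>2 * (\<rho> - q) * (1 - q\<^sup>2) = - 2 * u * (1 - \<rho>\<^sup>2 - u\<^sup>2)"
    and u0: "u < 0" "u\<^sup>2 < 1 - \<rho>\<^sup>2"
    using pair unfolding genuine_pair_iff[OF \<rho>(2,3)] tau_nondegenerate_def iota_nondegenerate_iff
    by auto
  have "q \<noteq> 0" using sc by (auto simp: tau_def)
  then have D: "q + 2 * t + 1 \<noteq> 0"
    "(4 * (1 - \<rho>\<^sup>2) - 3 * u\<^sup>2) * ((1 - q) * (q + 2 * t + 1))\<^sup>2 = (2 * (1 - \<rho>))\<^sup>2 * Delta t q"
    using discriminant_eq_Delta[OF _ _ _ _ k area u] q \<rho> by auto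
  have "4 * (1 - \<rho>\<^sup>2) - 3 * u\<^sup>2 \<noteq> 0" using discriminant_pos[OF u0(2)] by simp
  then show ?thesis
    unfolding second_root_in_Rats_iff[OF \<open>u \<in> \<rat>\<close> u0]
    using D q \<rho> \<open>q \<in> \<rat>\<close> \<open>t \<in> \<rat>\<close>
    by (intro rat_square_iff_of_mult_squares[of "(1 - q) * (q + 2 * t + 1)" "2 * (1 - \<rho>)"]) auto
qed

lemma partners_minus_iota:
  assumes \<rho>: "-1 < \<rho>" "\<rho> < 1" and sc: "scalene (k *\<^sub>R tau \<rho> q)"
    and pair: "genuine_pair \<rho> k q u"
  shows "partners \<rho> k q - {iota \<rho> u} =
    (if second_root (1 - \<rho>\<^sup>2) u \<in> \<rat> then {iota \<rho> (second_root (1 - \<rho>\<^sup>2) u)} else {})"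
proof -
  have u: "u < 0" "u\<^sup>2 < 1 - \<rho>\<^sup>2"
    using pair by (auto simp: genuine_pair_def iota_nondegenerate_iff)
  define w where "w = second_root (1 - \<rho>\<^sup>2) u"
  have "w \<noteq> u"
    using second_root_eq_iff[OF u] scalene_imp_iota_not_equilateral[OF \<rho> sc pair]
    by (simp add: w_def)
  then have "iota \<rho> w \<noteq> iota \<rho> u"
    using u second_root_props(2)[OF u] by (auto simp: iota_eq_iff power2_eq_iff w_def)
  then show ?thesis
    using genuine_pair_iff_second_root[OF \<rho> sc pair] by (auto simp: partners_def w_def)
qed

theorem proposition6p1:
  fixes \<rho> :: real
  assumes "\<rho> \<in> \<rat>" and "-1 < \<rho>" and "\<rho> < 1"
  shows
    "(\<forall>q\<in>\<rat>. \<forall>k u\<^sub>0 t.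
        tau_nondegenerate \<rho> q \<and> k = 2 * (1 - \<rho>) / (1 - q) \<and> scalene (k *\<^sub>R tau \<rho> q) \<and>
        u\<^sub>0 \<in> \<rat> \<and> genuine_pair \<rho> k q u\<^sub>0 \<and> t \<in> \<rat> \<and> u\<^sub>0 = 2 * t * (1 - \<rho>) \<longrightarrow>
          ((\<exists>T\<in>partners \<rho> k q. T \<noteq> iota \<rho> u\<^sub>0) \<longleftrightarrow> (\<exists>r\<in>\<rat>. r \<noteq> 0 \<and> Delta t q = r\<^sup>2)) \<and>
          ((\<exists>r\<in>\<rat>. r \<noteq> 0 \<and> Delta t q = r\<^sup>2) \<longrightarrow>
             (let u\<^sub>1 = (- u\<^sub>0 - sqrt (4 * (1 - \<rho>\<^sup>2) - 3 * u\<^sub>0\<^sup>2)) / 2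
              in u\<^sub>1 \<in> \<rat> \<and> genuine_pair \<rho> k q u\<^sub>1 \<and>
                 partners \<rho> k q - {iota \<rho> u\<^sub>0} = {iota \<rho> u\<^sub>1}))) \<and>
     (\<forall>q\<in>\<rat>. \<forall>k\<in>\<rat>. k \<noteq> 0 \<and> tau_nondegenerate \<rho> q \<and> scalene (k *\<^sub>R tau \<rho> q) \<longrightarrow>
        finite (partners \<rho> k q) \<and> card (partners \<rho> k q) \<le> 2)"
proof (intro conjI ballI allI impI, goal_cases)
  case (1 q k u\<^sub>0 t)
  then have pair: "genuine_pair \<rho> k q u\<^sub>0" and sc: "scalene (k *\<^sub>R tau \<rho> q)" by blast+
  have "second_root (1 - \<rho>\<^sup>2) u\<^sub>0 \<in> \<rat> \<longleftrightarrow> (\<exists>r\<in>\<rat>. r \<noteq> 0 \<and> Delta t q = r\<^sup>2)"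
    using 1 by (intro second_root_in_Rats_iff_Delta[OF assms _ _ _ sc pair]) blast+
  moreover have "(\<exists>T\<in>partners \<rho> k q. T \<noteq> iota \<rho> u\<^sub>0) \<longleftrightarrow> partners \<rho> k q - {iota \<rho> u\<^sub>0} \<noteq> {}"
    by blast
  ultimately show ?case
    unfolding partners_minus_iota[OF assms(2,3) sc pair] by simp
next
  case (2 q k u\<^sub>0 t)
  then have pair: "genuine_pair \<rho> k q u\<^sub>0" and sc: "scalene (k *\<^sub>R tau \<rho> q)" by blast+
  have "second_root (1 - \<rho>\<^sup>2) u\<^sub>0 \<in> \<rat> \<longleftrightarrow> (\<exists>r\<in>\<rat>. r \<noteq> 0 \<and> Delta t q = r\<^sup>2)"
    using 2 by (intro second_root_in_Rats_iff_Delta[OF assms _ _ _ sc pair]) blast+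
  then have "second_root (1 - \<rho>\<^sup>2) u\<^sub>0 \<in> \<rat>" using 2 by blast
  then show ?case
    using partners_minus_iota[OF assms(2,3) sc pair]
      genuine_pair_iff_second_root[OF assms(2,3) sc pair]
    by (simp add: second_root_def Let_def)
next
  case (3 q k)
  then show ?case using card_partners_le[OF assms(2,3)] by blast
next
  case (4 q k)
  then show ?case using card_partners_le[OF assms(2,3)] by blast
qed

end
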